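(* Let $M,\omega>0$ be constants such that $\|S(t)\|_{\mathcal L(\mathcal H)}\le Me^{-\omega t}$ for all $t\ge 0$. Assume that there exist two constants $\omega'\in[0,\omega)$ and $\gamma\in\mathbb R$ such that $$b^2Me^{\omega\tau}\int_0^t|k(s+\tau)|\,ds\le\gamma+\omega' t\qquad\text{for all }t\ge 0 .$$ Moreover, suppose that: (W) there exist $\rho>0$ and $C_\rho>0$, with $L(C_\rho)<\frac{\omega-\omega'}{M}$, such that if $U_0\in\mathcal H$ and $\tilde g\in C([0,\tau];\mathcal H)$ satisfy $$\|U_0\|_{\mathcal H}^2+\int_0^\tau|k(s)|\,\|\tilde g(s)\|_{\mathcal H}^2\,ds<\rho^2,\qquad(\ast)$$ then the abstract system $$U'(t)=\mathcal AU(t)-k(t)\mathcal BU(t-\tau)+F(U(t)),\qquad \mathcal BU(t-\tau)=\tilde g(t)\ \text{ for } t\in[0,\tau],\qquad U(0)=U_0,\qquad(\mathrm{P})$$ has a unique solution $U\in C([0,+\infty);\mathcal H)$ satisfying $\|U(t)\|_{\mathcal H}\le C_\rho$ for all $t>0$. Then, for every solution $U$ of $(\mathrm P)$ with initial data satisfying $(\ast)$, $$\|U(t)\|_{\mathcal H}\le\tilde M\left(\|U_0\|_{\mathcal H}+\int_0^\tau e^{\omega s}|k(s)|\,\|\tilde g(s)\|_{\mathcal H}\,ds\right)e^{-(\omega-\omega'-ML(C_\rho))t},\qquad t\ge 0,$$ with $\tilde M=Me^{\gamma}$.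
   Context: Setting. $H$ is a Hilbert space and $A$ is a positive self-adjoint operator in $H$ with dense domain $D(A)$ and compact inverse. $\tau>0$; $B$ is a bounded linear operator of $H$ into itself with adjoint $B^*$, and $b:=\|B\|_{\mathcal L(H)}=\|B^*\|_{\mathcal L(H)}$. The function $k:[0,+\infty)\to\mathbb R$ is in $L^1_{loc}([0,+\infty))$ and there is a constant $C^*$ with $\int_{\max(0,t-\tau)}^t|k(s)|\,ds<C^*$ for all $t>0$. The memory kernel $\mu:[0,+\infty)\to[0,+\infty)$ satisfies: $\mu\in C^1(\mathbb R^+)\cap L^1(\mathbb R^+)$; $\mu(0)=\mu_0>0$; $\int_0^{+\infty}\mu(t)\,dt=\tilde\mu<1$; $\mu'(t)\le-\delta_0\mu(t)$ for some $\delta_0>0$. The functional $\psi:D(A^{1/2})\to\mathbb R$ has a Gâteaux derivative $D\psi(u)$ at every $u\in D(A^{1/2})$ and satisfies: - for every $u\in D(A^{1/2})$ there is $c(u)>0$ with $|D\psi(u)(v)|\le c(u)\|v\|_H$ for all $v\in D(A^{1/2})$; $\nabla\psi(u)\in H$ denotes the unique vector representing (the extension to $H$ of) $D\psi(u)$, i.e. $\langle\nabla\psi(u),v\rangle_H=D\psi(u)(v)$; - for all $r>0$ there is a constant $L(r)>0$ with $\|\nabla\psi(u)-\nabla\psi(v)\|_H\le L(r)\|A^{1/2}(u-v)\|_H$ whenever $\|A^{1/2}u\|_H\le r$ and $\|A^{1/2}v\|_H\le r$; - $\psi(0)=0$, $\nabla\psi(0)=0$, and there is a strictly increasing continuous function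 $h$ with $\|\nabla\psi(u)\|_H\le h(\|A^{1/2}u\|_H)\|A^{1/2}u\|_H$ for all $u\in D(A^{1/2})$. $L^2_\mu((0,+\infty);D(A^{1/2}))$ is the Hilbert space of $D(A^{1/2})$-valued functions on $(0,+\infty)$ with scalar product $\int_0^\infty\mu(s)\langle A^{1/2}\varphi(s),A^{1/2}\phi(s)\rangle_H\,ds$, and $$\mathcal H=D(A^{1/2})\times H\times L^2_\mu((0,+\infty);D(A^{1/2})),$$ $$\langle(u,v,w),(\tilde u,\tilde v,\tilde w)\rangle_{\mathcal H}=(1-\tilde\mu)\langle A^{1/2}u,A^{1/2}\tilde u\rangle_H+\langle v,\tilde v\rangle_H+\int_0^\infty\mu(s)\langle A^{1/2}w,A^{1/2}\tilde w\rangle_H\,ds.$$ The operator $\mathcal A$ in $\mathcal H$ is $$\mathcal A(u,v,w)=\Big(v,\ -(1-\tilde\mu)Au-\int_0^{+\infty}\mu(s)Aw(s)\,ds,\ -w_s+v\Big),$$ where the second component is understood as $-A\big((1-\tilde\mu)u+\int_0^{+\infty}\mu(s)w(s)\,ds\big)$, with domain the set of $(u,v,w)\in D(A^{1/2})\times D(A^{1/2})\times L^2_\mu((0,+\infty);D(A^{1/2}))$ such that $(1-\tilde\mu)u+\int_0^{+\infty}\mu(s)w(s)\,ds\in D(A)$, $w_s\in L^2_\mu((0,+\infty);D(A^{1/2}))$ and $w(0)=0$. It is known that $\mathcal A$ generates an exponentially stable $C_0$-semigroup $\{S(t)\}_{t\ge0}$ on $\mathcal H$, so constants $M,\omega>0$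 as in the claim exist. The bounded operator $\mathcal B:\mathcal H\to\mathcal H$ is $\mathcal B(u,v,w)=(0,BB^*v,0)$, and $F(u,v,w)=(0,\nabla\psi(u),0)$. Then $F(0)=0$ and for each $r>0$ there is a constant, again denoted $L(r)>0$, with $\|F(U)-F(V)\|_{\mathcal H}\le L(r)\|U-V\|_{\mathcal H}$ whenever $\|U\|_{\mathcal H}\le r$, $\|V\|_{\mathcal H}\le r$; in the claim $L(\cdot)$ denotes this Lipschitz constant of $F$. Solutions of $(\mathrm P)$ are mild solutions: $U$ is continuous with values in $\mathcal H$ and $U(t)=S(t)U_0+\int_0^tS(t-s)\big[-k(s)\mathcal BU(s-\tau)+F(U(s))\big]ds$, where $\mathcal BU(s-\tau)$ is replaced by $\tilde g(s)$ for $s\in[0,\tau]$. The system $(\mathrm P)$ is the abstract form, with $U=(u,u_t,\eta^t)$, $\eta^t(s)=u(t)-u(t-s)$, $U_0=(u_0(0),u_1,\eta_0)$, $\eta_0(s)=u_0(0)-u_0(-s)$, $\tilde g(t)=(0,Bg(t-\tau),0)$, of $$u_{tt}(t)+Au(t)-\int_0^{+\infty}\mu(s)Au(t-s)\,ds+k(t)BB^*u_t(t-\tau)=\nabla\psi(u(t)),\ t>0,$$ with $u(t)=u_0(t)$ for $t\le0$, $u_t(0)=u_1$, $B^*u_t(t)=g(t)$ for $t\in(-\tau,0)$. *)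

theory Defs
  imports "HOL-Analysis.Analysis"
begin

text \<open>
  An unbounded operator is a total function \<open>T\<close> together with a domain \<open>D\<close>; only the values
  of \<open>T\<close> on \<open>D\<close> are ever used.
\<close>

definition linear_map_on :: "'h::real_vector set \<Rightarrow> ('h \<Rightarrow> 'b::real_vector) \<Rightarrow> bool" where
  "linear_map_on D T \<longleftrightarrow> subspace D \<and> (\<forall>x\<in>D. \<forall>y\<in>D. T (x + y) = T x + T y)
     \<and> (\<forall>c. \<forall>x\<in>D. T (c *\<^sub>R x) = c *\<^sub>R T x)"

text \<open>
  The last clause says that the graph of the adjoint, i.e. the set of all \<open>(y, z)\<close> with
  \<open>\<langle>T x, y\<rangle> = \<langle>x, z\<rangle>\<close> for all \<open>x \<in> D\<close>, is the graph of \<open>T\<close>, so the domains agree as well.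
\<close>

definition self_adjoint_on :: "'h::real_inner set \<Rightarrow> ('h \<Rightarrow> 'h) \<Rightarrow> bool" where
  "self_adjoint_on D T \<longleftrightarrow> linear_map_on D T \<and> closure D = UNIV
     \<and> (\<forall>y z. (\<forall>x\<in>D. T x \<bullet> y = x \<bullet> z) \<longleftrightarrow> y \<in> D \<and> z = T y)"

definition positive_on :: "'h::real_inner set \<Rightarrow> ('h \<Rightarrow> 'h) \<Rightarrow> bool" where
  "positive_on D T \<longleftrightarrow> (\<forall>x\<in>D. 0 \<le> T x \<bullet> x)"

definition has_compact_inverse :: "'h::real_normed_vector set \<Rightarrow> ('h \<Rightarrow> 'h) \<Rightarrow> bool" where
  "has_compact_inverse D T \<longleftrightarrow> bij_betw T D UNIV
     \<and> (\<forall>E. bounded E \<longrightarrow> compact (closure (inv_into D T ` E)))"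

definition is_sqrt_of ::
  "'h::real_inner set \<Rightarrow> ('h \<Rightarrow> 'h) \<Rightarrow> 'h set \<Rightarrow> ('h \<Rightarrow> 'h) \<Rightarrow> bool" where
  "is_sqrt_of V R D A \<longleftrightarrow> self_adjoint_on V R \<and> positive_on V R
     \<and> D = {x \<in> V. R x \<in> V} \<and> (\<forall>x\<in>D. R (R x) = A x)"

definition memory_mass :: "(real \<Rightarrow> real) \<Rightarrow> real" where
  "memory_mass \<mu> = (LINT t:{0..}|lebesgue. \<mu> t)"

text \<open>
  Both readings of \<open>C\<^sup>1\<close> on the half-line (with or without a one-sided derivative at \<open>0\<close>)
  satisfy the following conditions.
\<close>

definition memory_kernel :: "(real \<Rightarrow> real) \<Rightarrow> bool" where
  "memory_kernel \<mu> \<longleftrightarrow> (\<forall>t\<ge>0. 0 \<le> \<mu> t) \<and> continuous_on {0..} \<mu>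
     \<and> (\<forall>t>0. \<mu> differentiable (at t)) \<and> continuous_on {0<..} (deriv \<mu>)
     \<and> \<mu> absolutely_integrable_on {0..} \<and> 0 < \<mu> 0
     \<and> memory_mass \<mu> < 1
     \<and> (\<exists>\<delta>>0. \<forall>t>0. deriv \<mu> t \<le> - \<delta> * \<mu> t)"

definition delay_coefficient :: "real \<Rightarrow> (real \<Rightarrow> real) \<Rightarrow> bool" where
  "delay_coefficient \<tau> k \<longleftrightarrow> (\<forall>T>0. k absolutely_integrable_on {0..T})
     \<and> (\<exists>C. \<forall>t>0. (LINT s:{max 0 (t - \<tau>)..t}|lebesgue. \<bar>k s\<bar>) < C)"

definition has_gateaux_derivative ::
  "'h::real_normed_vector set \<Rightarrow> ('h \<Rightarrow> 'h) \<Rightarrow> ('h \<Rightarrow> real) \<Rightarrow> 'h \<Rightarrow> ('h \<Rightarrow> real) \<Rightarrow> bool" where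
  "has_gateaux_derivative V R \<psi> u d \<longleftrightarrow> linear_map_on V d
     \<and> (\<exists>c. \<forall>v\<in>V. \<bar>d v\<bar> \<le> c * norm (R v))
     \<and> (\<forall>v\<in>V. ((\<lambda>t. \<psi> (u + t *\<^sub>R v)) has_real_derivative d v) (at 0))"

text \<open>
  In what follows \<open>V\<close> and \<open>R\<close> stand for \<open>D(A\<^sup>1\<^sup>/\<^sup>2)\<close> and \<open>A\<^sup>1\<^sup>/\<^sup>2\<close>, and \<open>V\<close> carries the norm
  \<open>\<parallel>R u\<parallel>\<close>. As \<open>V\<close> is dense, \<open>G u\<close> below is the unique vector representing \<open>D\<psi>(u)\<close>.
\<close>

definition admissible_potential ::
  "'h::real_inner set \<Rightarrow> ('h \<Rightarrow> 'h) \<Rightarrow> ('h \<Rightarrow> real) \<Rightarrow> ('h \<Rightarrow> 'h \<Rightarrow> real) \<Rightarrow> ('h \<Rightarrow> 'h) \<Rightarrow> bool" where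
  "admissible_potential V R \<psi> D\<psi> G \<longleftrightarrow>
     (\<forall>u\<in>V. has_gateaux_derivative V R \<psi> u (D\<psi> u))
     \<and> (\<forall>u\<in>V. \<exists>c>0. \<forall>v\<in>V. \<bar>D\<psi> u v\<bar> \<le> c * norm v)
     \<and> (\<forall>u\<in>V. \<forall>v\<in>V. G u \<bullet> v = D\<psi> u v)
     \<and> (\<forall>r>0. \<exists>l>0. \<forall>u\<in>V. \<forall>v\<in>V. norm (R u) \<le> r \<longrightarrow> norm (R v) \<le> r \<longrightarrow>
            norm (G u - G v) \<le> l * norm (R (u - v)))
     \<and> \<psi> 0 = 0 \<and> G 0 = 0
     \<and> (\<exists>h::real \<Rightarrow> real. strict_mono_on {0..} h \<and> continuous_on {0..} h
            \<and> (\<forall>u\<in>V. norm (G u) \<le> h (norm (R u)) * norm (R u)))"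

text \<open>
  The elements of \<open>L\<^sup>2\<^sub>\<mu>((0,\<infinity>); V)\<close> are represented by functions. Since \<open>R\<close> is an isometry of
  \<open>V\<close> onto the whole space, measurability of \<open>w\<close> as a \<open>V\<close>-valued function is that of \<open>R \<circ> w\<close>.
\<close>

definition L2_mem ::
  "'h::{real_inner,banach,second_countable_topology} set \<Rightarrow> ('h \<Rightarrow> 'h) \<Rightarrow> (real \<Rightarrow> real)
    \<Rightarrow> (real \<Rightarrow> 'h) set" where
  "L2_mem V R \<mu> = {w. (\<forall>s>0. w s \<in> V)
     \<and> set_borel_measurable lebesgue {0<..} (\<lambda>s. R (w s))
     \<and> (\<lambda>s. \<mu> s * (norm (R (w s)))\<^sup>2) absolutely_integrable_on {0<..}}"

definition phase_reps ::
  "'h::{real_inner,banach,second_countable_topology} set \<Rightarrow> ('h \<Rightarrow> 'h) \<Rightarrow> (real \<Rightarrow> real)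
    \<Rightarrow> ('h \<times> 'h \<times> (real \<Rightarrow> 'h)) set" where
  "phase_reps V R \<mu> = V \<times> UNIV \<times> L2_mem V R \<mu>"

definition phase_inner ::
  "('h::{real_inner,banach,second_countable_topology} \<Rightarrow> 'h) \<Rightarrow> (real \<Rightarrow> real)
    \<Rightarrow> 'h \<times> 'h \<times> (real \<Rightarrow> 'h) \<Rightarrow> 'h \<times> 'h \<times> (real \<Rightarrow> 'h) \<Rightarrow> real" where
  "phase_inner R \<mu> = (\<lambda>(u, v, w) (u', v', w').
     (1 - memory_mass \<mu>) * (R u \<bullet> R u') + v \<bullet> v'
       + (LINT s:{0<..}|lebesgue. \<mu> s * (R (w s) \<bullet> R (w' s))))"

text \<open>
  The phase space depends on \<open>A\<close> and \<open>\<mu>\<close>, so it is not a type by itself. It is given as a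
  Hilbert space type \<open>'x\<close> with a map \<open>Q\<close> that sends a triple \<open>(u, v, w)\<close> to its class modulo
  equality almost everywhere in the third component. The two conditions make \<open>Q\<close> the quotient
  map: it is linear on triples, and \<open>Q p = Q q\<close> holds exactly when \<open>p - q\<close> has norm \<open>0\<close>. Thus
  \<open>'x\<close> is the phase space up to a unitary isomorphism. It is separable, like the space of
  \<open>A\<close> itself (the range of the compact operator \<open>A\<^sup>-\<^sup>1\<close> is separable and dense).
\<close>

definition phase_space ::
  "'h::{real_inner,banach,second_countable_topology} set \<Rightarrow> ('h \<Rightarrow> 'h) \<Rightarrow> (real \<Rightarrow> real)
    \<Rightarrow> ('h \<times> 'h \<times> (real \<Rightarrow> 'h) \<Rightarrow> 'x::{real_inner,banach,second_countable_topology}) \<Rightarrow> bool" where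
  "phase_space V R \<mu> Q \<longleftrightarrow> Q ` phase_reps V R \<mu> = UNIV
     \<and> (\<forall>p\<in>phase_reps V R \<mu>. \<forall>q\<in>phase_reps V R \<mu>. Q p \<bullet> Q q = phase_inner R \<mu> p q)"

text \<open>
  \<open>w\<close> is (almost everywhere equal to) a locally absolutely continuous function with weak
  derivative \<open>z\<close> and value \<open>a\<close> at \<open>0\<close>. Points with \<open>\<mu> s = 0\<close> are negligible in \<open>L\<^sup>2\<^sub>\<mu>\<close>; as
  \<open>\<mu>\<close> is decreasing, \<open>z \<in> L\<^sup>2\<^sub>\<mu>\<close> is integrable on \<open>(0, s)\<close> if \<open>\<mu> s > 0\<close>. Here and in
  \<open>generator_A\<close> the integrals are taken in \<open>H\<close>; they agree with the \<open>V\<close>-valued ones because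
  \<open>V\<close> embeds continuously in \<open>H\<close>.
\<close>

definition has_mem_derivative ::
  "(real \<Rightarrow> real) \<Rightarrow> (real \<Rightarrow> 'h::{real_inner,banach,second_countable_topology}) \<Rightarrow> 'h
    \<Rightarrow> (real \<Rightarrow> 'h) \<Rightarrow> bool" where
  "has_mem_derivative \<mu> w a z \<longleftrightarrow>
     (AE s in lebesgue. 0 < s \<and> 0 < \<mu> s \<longrightarrow> w s = a + (LINT r:{0<..s}|lebesgue. z r))"

text \<open>The operator \<open>\<A>\<close>, as a graph; \<open>z\<close> is \<open>w\<^sub>s\<close>.\<close>

definition generator_A ::
  "'h::{real_inner,banach,second_countable_topology} set \<Rightarrow> ('h \<Rightarrow> 'h) \<Rightarrow> 'h set \<Rightarrow> ('h \<Rightarrow> 'h)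
    \<Rightarrow> (real \<Rightarrow> real)
    \<Rightarrow> ('h \<times> 'h \<times> (real \<Rightarrow> 'h) \<Rightarrow> 'x::{real_inner,banach,second_countable_topology})
    \<Rightarrow> ('x \<times> 'x) set" where
  "generator_A D A V R \<mu> Q =
     {(Q (u, v, w),
       Q (v, - A ((1 - memory_mass \<mu>) *\<^sub>R u + (LINT s:{0<..}|lebesgue. \<mu> s *\<^sub>R w s)),
          \<lambda>s. - z s + v)) | u v w z.
        u \<in> V \<and> v \<in> V \<and> w \<in> L2_mem V R \<mu>
        \<and> (1 - memory_mass \<mu>) *\<^sub>R u + (LINT s:{0<..}|lebesgue. \<mu> s *\<^sub>R w s) \<in> D
        \<and> z \<in> L2_mem V R \<mu> \<and> has_mem_derivative \<mu> w 0 z}"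

definition c0_semigroup :: "(real \<Rightarrow> 'x::real_normed_vector \<Rightarrow> 'x) \<Rightarrow> bool" where
  "c0_semigroup S \<longleftrightarrow> (\<forall>t\<ge>0. bounded_linear (S t)) \<and> (\<forall>x. S 0 x = x)
     \<and> (\<forall>s\<ge>0. \<forall>t\<ge>0. \<forall>x. S (s + t) x = S s (S t x))
     \<and> (\<forall>x. ((\<lambda>t. S t x) \<longlongrightarrow> x) (at_right 0))"

definition generated_by :: "(real \<Rightarrow> 'x::real_normed_vector \<Rightarrow> 'x) \<Rightarrow> ('x \<times> 'x) set \<Rightarrow> bool" where
  "generated_by S \<Gamma> \<longleftrightarrow> c0_semigroup S
     \<and> \<Gamma> = {(x, y). ((\<lambda>t. (S t x - x) /\<^sub>R t) \<longlongrightarrow> y) (at_right 0)}"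

text \<open>
  For the next two maps the choice of representative made by \<open>inv_into\<close> does not matter: the
  first two components are determined by the class.
\<close>

definition delay_op ::
  "'h::{real_inner,banach,second_countable_topology} set \<Rightarrow> ('h \<Rightarrow> 'h) \<Rightarrow> (real \<Rightarrow> real)
    \<Rightarrow> ('h \<times> 'h \<times> (real \<Rightarrow> 'h) \<Rightarrow> 'x) \<Rightarrow> ('h \<Rightarrow> 'h) \<Rightarrow> 'x \<Rightarrow> 'x" where
  "delay_op V R \<mu> Q B X =
     (case inv_into (phase_reps V R \<mu>) Q X of (u, v, w) \<Rightarrow> Q (0, B (adjoint B v), \<lambda>_. 0))"

definition source_map ::
  "'h::{real_inner,banach,second_countable_topology} set \<Rightarrow> ('h \<Rightarrow> 'h) \<Rightarrow> (real \<Rightarrow> real)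
    \<Rightarrow> ('h \<times> 'h \<times> (real \<Rightarrow> 'h) \<Rightarrow> 'x) \<Rightarrow> ('h \<Rightarrow> 'h) \<Rightarrow> 'x \<Rightarrow> 'x" where
  "source_map V R \<mu> Q G X =
     (case inv_into (phase_reps V R \<mu>) Q X of (u, v, w) \<Rightarrow> Q (0, G u, \<lambda>_. 0))"

text \<open>
  Mild solutions of \<open>U' = \<A>U - k \<B>U(\<cdot> - \<tau>) + F(U)\<close>, \<open>U(0) = U\<^sub>0\<close>, with \<open>\<B>U(t - \<tau>)\<close> replaced by
  \<open>g t\<close> for \<open>t \<in> [0,\<tau>]\<close>. Only \<open>U\<close> on \<open>[0,\<infinity>)\<close> matters.
\<close>

definition mild_solution ::
  "(real \<Rightarrow> 'x::{banach,second_countable_topology} \<Rightarrow> 'x) \<Rightarrow> (real \<Rightarrow> real) \<Rightarrow> ('x \<Rightarrow> 'x) \<Rightarrow> ('x \<Rightarrow> 'x)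
    \<Rightarrow> real \<Rightarrow> 'x \<Rightarrow> (real \<Rightarrow> 'x) \<Rightarrow> (real \<Rightarrow> 'x) \<Rightarrow> bool" where
  "mild_solution S k \<B> F \<tau> U0 g U \<longleftrightarrow> continuous_on {0..} U
     \<and> (\<forall>t\<ge>0.
          (let f = (\<lambda>s. S (t - s) (- k s *\<^sub>R (if s \<le> \<tau> then g s else \<B> (U (s - \<tau>))) + F (U s)))
           in f absolutely_integrable_on {0..t}
              \<and> U t = S t U0 + (LINT s:{0..t}|lebesgue. f s)))"

definition small_data ::
  "(real \<Rightarrow> real) \<Rightarrow> real \<Rightarrow> real \<Rightarrow> 'x::real_normed_vector \<Rightarrow> (real \<Rightarrow> 'x) \<Rightarrow> bool" where
  "small_data k \<tau> \<rho> U0 g \<longleftrightarrow> continuous_on {0..\<tau>} g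
     \<and> (norm U0)\<^sup>2 + (LINT s:{0..\<tau>}|lebesgue. \<bar>k s\<bar> * (norm (g s))\<^sup>2) < \<rho>\<^sup>2"

definition lipschitz_constants ::
  "('x::real_normed_vector \<Rightarrow> 'x) \<Rightarrow> (real \<Rightarrow> real) \<Rightarrow> bool" where
  "lipschitz_constants F L \<longleftrightarrow> (\<forall>r>0. 0 < L r
     \<and> (\<forall>X Y. norm X \<le> r \<longrightarrow> norm Y \<le> r \<longrightarrow> norm (F X - F Y) \<le> L r * norm (X - Y)))"

end

theory Submission imports Defs begin

text \<open>
  The decay estimate is a perturbation argument in the variation-of-constants formula. The
  semigroup decays like \<open>M exp (- \<omega> t)\<close>; multiplying a solution by \<open>exp (\<omega> t)\<close> removes this decay,
  and Gronwall's inequality measures how much the two perturbations can give back. The delay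
  term, shifted by \<open>\<tau>\<close>, contributes \<open>b\<^sup>2 M exp (\<omega> \<tau>) \<integral>\<^sub>0\<^sup>t \<bar>k (s + \<tau>)\<bar> ds \<le> \<gamma> + \<omega>' t\<close> to the
  exponent, and the source term contributes \<open>M L(C\<rho>) t\<close> as long as the solution stays in the ball
  of radius \<open>C\<rho>\<close>.

  The solution in the claim is not assumed to stay in that ball, so it has to be identified with
  the bounded one provided by the hypothesis on well-posedness. Both tasks are handled by one
  estimate for the difference of two mild solutions, \<open>mild_solution_stability\<close>. Applied to two
  solutions with the same data, in an arbitrarily large ball, it gives uniqueness on every
  compact interval. Applied to the bounded solution and the equilibrium \<open>0\<close>, it gives the decay.

  The abstract estimate needs \<open>\<parallel>\<B> X - \<B> Y\<parallel> \<le> b\<^sup>2 \<parallel>X - Y\<parallel>\<close> (\<open>delay_op_lipschitz\<close>) and, for \<open>0\<close> to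
  be a solution, \<open>\<B> 0 = 0\<close> and \<open>F 0 = 0\<close> (\<open>delay_op_zero\<close>, \<open>source_map_zero\<close>). These rest on the
  existence of the adjoint of \<open>B\<close>, obtained from the Riesz representation theorem, and on the fact
  that the norm of the phase space controls the first two components of a triple. As \<open>k\<close> is only
  locally integrable, Gronwall's inequality is proved for integrable kernels
  (\<open>gronwall_integrable_kernel\<close>).
\<close>

section \<open>Gronwall's inequality with an integrable kernel\<close>

text \<open>
  For a kernel that is merely integrable, \<open>A t = \<integral>\<^sub>0\<^sup>t a\<close> need not be differentiable, so the usual
  proof by differentiation is replaced by a discrete one. With
  \<open>W t = c + \<integral>\<^sub>0\<^sup>t a v\<close>, monotonicity of \<open>W\<close> gives \<open>W t (1 - (A t - A s)) \<le> W s\<close>. On intervals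
  where \<open>A\<close> increases little, \<open>1 / (1 - y)\<close> is at most \<open>exp (\<theta> y)\<close> for any fixed \<open>\<theta> > 1\<close>. The
  resulting estimate \<open>W t \<le> W s exp (\<theta> (A t - A s))\<close> is transitive, hence passes from short
  intervals to the whole one by the Bolzano principle. Finally \<open>\<theta>\<close> tends to \<open>1\<close>.
\<close>

lemma gronwall_integrable_kernel:
  fixes a v :: "real \<Rightarrow> real"
  assumes T: "0 \<le> T"
    and a: "a absolutely_integrable_on {0..T}" "\<And>s. s \<in> {0..T} \<Longrightarrow> 0 \<le> a s"
    and v: "continuous_on {0..T} v" "\<And>s. s \<in> {0..T} \<Longrightarrow> 0 \<le> v s"
    and le: "\<And>t. t \<in> {0..T} \<Longrightarrow> v t \<le> c + integral {0..t} (\<lambda>s. a s * v s)"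
  shows "v T \<le> c * exp (integral {0..T} a)"
proof -
  define A where "A t = integral {0..t} a" for t
  define W where "W t = c + integral {0..t} (\<lambda>s. a s * v s)" for t
  have a_int: "a integrable_on {0..T}"
    using set_lebesgue_integral_eq_integral(1)[OF a(1)] .
  have "(\<lambda>s. v s * a s) absolutely_integrable_on {0..T}"
    by (rule absolutely_integrable_bounded_measurable_product_real)
      (use a v in \<open>auto intro!: continuous_imp_measurable_on_sets_lebesgue
        compact_imp_bounded compact_continuous_image\<close>)
  then have av_int: "(\<lambda>s. a s * v s) integrable_on {0..T}"
    using set_lebesgue_integral_eq_integral(1) by (simp add: mult.commute)
  have sub: "f integrable_on {s..t}" if "f integrable_on {0..T}" "0 \<le> s" "t \<le> T"
    for f :: "real \<Rightarrow> real" and s t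
    using that by (meson integrable_on_subinterval atLeastatMost_subset_iff)
  have A_diff: "A t - A s = integral {s..t} a"
    and W_diff: "W t - W s = integral {s..t} (\<lambda>s. a s * v s)"
    if "0 \<le> s" "s \<le> t" "t \<le> T" for s t
    using that Henstock_Kurzweil_Integration.integral_combine[OF _ _ sub[OF a_int, of 0 t], of s]
      Henstock_Kurzweil_Integration.integral_combine[OF _ _ sub[OF av_int, of 0 t], of s] unfolding A_def W_def by auto
  have A_mono: "A s \<le> A t" if "0 \<le> s" "s \<le> t" "t \<le> T" for s t
  proof -
    have "0 \<le> integral {s..t} a"
      using that a(2) sub[OF a_int] by (intro integral_nonneg) auto
    then show ?thesis using A_diff[OF that] by simp
  qed
  have W_mono: "W s \<le> W t" if "0 \<le> s" "s \<le> t" "t \<le> T" for s t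
  proof -
    have "0 \<le> integral {s..t} (\<lambda>s. a s * v s)"
      using that a(2) v(2) sub[OF av_int] by (intro integral_nonneg) auto
    then show ?thesis using W_diff[OF that] by simp
  qed
  have vW: "v t \<le> W t" and W0: "0 \<le> W t" if "t \<in> {0..T}" for t
    using le[OF that] v(2)[OF that] unfolding W_def by auto
  have step: "W t * (1 - (A t - A s)) \<le> W s" if "0 \<le> s" "s \<le> t" "t \<le> T" for s t
  proof -
    have "W t - W s \<le> integral {s..t} (\<lambda>s. a s * W t)"
      unfolding W_diff[OF that]
    proof (rule integral_le)
      fix x assume "x \<in> {s..t}"
      then show "a x * v x \<le> a x * W t"
        using that a(2)[of x] vW[of x] W_mono[of x t] by (intro mult_left_mono) auto
    qed (use sub[OF a_int] sub[OF av_int] that in \<open>auto intro: integrable_on_mult_left\<close>)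
    also have "\<dots> = (A t - A s) * W t"
      using A_diff[OF that] by simp
    finally show ?thesis by (simp add: algebra_simps)
  qed
  have growth: "W T \<le> c * exp (\<theta> * A T)" if \<theta>: "1 < \<theta>" for \<theta>
  proof -
    define P where "P s t \<longleftrightarrow> (0 \<le> s \<and> s \<le> t \<and> t \<le> T \<longrightarrow> W t \<le> W s * exp (\<theta> * (A t - A s)))" for s t
    have "P 0 T"
    proof (rule Bolzano)
      show "0 \<le> T" by fact
    next
      fix r s t assume P: "P r s" "P s t" and ord: "r \<le> s" "s \<le> t"
      show "P r t" unfolding P_def
      proof
        assume b: "0 \<le> r \<and> r \<le> t \<and> t \<le> T"
        have "W t \<le> W s * exp (\<theta> * (A t - A s))" using P(2) b ord by (simp add: P_def)
        also have "\<dots> \<le> (W r * exp (\<theta> * (A s - A r))) * exp (\<theta> * (A t - A s))"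
          using P(1) b ord by (intro mult_right_mono) (simp_all add: P_def)
        also have "\<dots> = W r * exp (\<theta> * (A t - A r))"
          by (simp add: exp_add[symmetric] algebra_simps)
        finally show "W t \<le> W r * exp (\<theta> * (A t - A r))" .
      qed
    next
      fix x assume x: "0 \<le> x" "x \<le> T"
      \<comment> \<open>An increment \<open>y\<close> of \<open>A\<close> below this threshold satisfies \<open>1 / (1 - y) \<le> \<theta>\<close>.\<close>
      define \<epsilon> where "\<epsilon> = 1 - 1 / \<theta>"
      have "\<epsilon> > 0" using \<theta> by (simp add: \<epsilon>_def field_simps)
      moreover have "continuous_on {0..T} A"
        unfolding A_def using a_int by (rule indefinite_integral_continuous_1)
      ultimately obtain d where d: "d > 0"
        "\<And>y. y \<in> {0..T} \<Longrightarrow> dist y x < d \<Longrightarrow> dist (A y) (A x) < \<epsilon> / 2"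
        using x unfolding continuous_on_iff by (metis atLeastAtMost_iff half_gt_zero)
      have "P s t" if st: "s \<le> x \<and> x \<le> t \<and> t - s < d" for s t
        unfolding P_def
      proof
        assume b: "0 \<le> s \<and> s \<le> t \<and> t \<le> T"
        define y where "y = A t - A s"
        have "dist (A s) (A x) < \<epsilon> / 2" "dist (A t) (A x) < \<epsilon> / 2"
          using d(2)[of s] d(2)[of t] b st by (auto simp: dist_real_def)
        then have "y < \<epsilon>" unfolding y_def dist_real_def by linarith
        then have y: "1 / \<theta> < 1 - y" by (simp add: \<epsilon>_def)
        have y0: "0 \<le> y" using A_mono[of s t] b by (simp add: y_def)
        moreover have "0 < 1 / \<theta>" using \<theta> by simp
        ultimately have ypos: "0 < 1 - y" using y by linarith
        have "1 / (1 - y) \<le> \<theta>" using y ypos \<theta> by (simp add: field_simps)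
        then have "y * (1 / (1 - y)) \<le> y * \<theta>" using y0 by (rule mult_left_mono)
        moreover have "1 / (1 - y) = 1 + y * (1 / (1 - y))" using ypos by (simp add: field_simps)
        ultimately have inv: "1 / (1 - y) \<le> exp (\<theta> * y)"
          using exp_ge_add_one_self[of "\<theta> * y"] unfolding mult.commute[of y \<theta>] by linarith
        have "W t \<le> W s * (1 / (1 - y))"
          using step[of s t] b ypos by (simp add: y_def field_simps)
        also have "\<dots> \<le> W s * exp (\<theta> * y)"
          using inv W0[of s] b by (intro mult_left_mono) auto
        finally show "W t \<le> W s * exp (\<theta> * (A t - A s))" by (simp add: y_def)
      qed
      then show "\<exists>d>0. \<forall>s t. s \<le> x \<and> x \<le> t \<and> t - s < d \<longrightarrow> P s t"
        using d(1) by blast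
    qed
    then show ?thesis using T by (simp add: P_def A_def W_def)
  qed
  have "W T \<le> c * exp (1 * A T)"
  proof (rule tendsto_lowerbound)
    show "((\<lambda>\<theta>. c * exp (\<theta> * A T)) \<longlongrightarrow> c * exp (1 * A T)) (at_right 1)"
      by (intro tendsto_intros)
    show "\<forall>\<^sub>F \<theta> in at_right 1. W T \<le> c * exp (\<theta> * A T)"
      using growth by (auto simp: eventually_at_filter)
  qed simp
  then show ?thesis using vW[of T] T by (simp add: A_def)
qed

section \<open>Adjoints of bounded operators on a Hilbert space\<close>

lemma norm_diff_squared: "(norm (x - y))\<^sup>2 = x \<bullet> x + y \<bullet> y - 2 * (x \<bullet> y)"
  unfolding power2_norm_eq_inner
  by (simp add: inner_diff_left inner_diff_right inner_commute[of y x])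

text \<open>
  The representing vector is the minimiser of \<open>J x = \<parallel>x\<parallel>\<^sup>2 / 2 - f x\<close>. This functional is bounded
  below, and the parallelogram law makes every minimising sequence a Cauchy sequence. At the
  minimum, a variation in the direction \<open>x\<close> cannot decrease \<open>J\<close>, which forces \<open>f x = x \<bullet> z\<close>.
\<close>

theorem riesz_representation:
  fixes f :: "'a::{real_inner,banach} \<Rightarrow> real"
  assumes "bounded_linear f"
  shows "\<exists>z. \<forall>x. f x = x \<bullet> z"
proof -
  interpret f: bounded_linear f by fact
  define J where "J x = (norm x)\<^sup>2 / 2 - f x" for x
  obtain K where K: "\<And>x. \<bar>f x\<bar> \<le> norm x * K" using f.bounded by auto
  have J_below: "- K\<^sup>2 / 2 \<le> J x" for x
  proof -
    have "0 \<le> (norm x - K)\<^sup>2" by simp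
    then have "norm x * K \<le> (norm x)\<^sup>2 / 2 + K\<^sup>2 / 2" by (simp add: power2_diff)
    then show ?thesis using K[of x] by (simp add: J_def)
  qed
  define m where "m = (INF x. J x)"
  have bdd: "bdd_below (range J)" using J_below by (rule bdd_belowI2)
  have m_le: "m \<le> J x" for x unfolding m_def using bdd by (auto intro: cINF_lower)
  have "\<exists>x. J x < m + e" if "0 < e" for e
    using that cINF_less_iff[of UNIV J "m + e"] bdd by (auto simp: m_def)
  then have "\<forall>n. \<exists>x. J x < m + inverse (real (Suc n))" by simp
  then obtain X where X: "\<And>n. J (X n) < m + inverse (real (Suc n))" by metis
  have para: "(norm (x - y))\<^sup>2 / 4 \<le> J x + J y - 2 * m" for x y
  proof -
    have "(norm (x - y))\<^sup>2 / 4 = J x + J y - 2 * J ((1/2) *\<^sub>R (x + y))"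
      unfolding J_def f.scaleR f.add norm_diff_squared power2_norm_eq_inner
      by (simp add: inner_add_left inner_add_right inner_commute[of y x]
          algebra_simps add_divide_distrib diff_divide_distrib)
    then show ?thesis using m_le[of "(1/2) *\<^sub>R (x + y)"] by simp
  qed
  have "Cauchy X"
  proof (rule metric_CauchyI)
    fix e :: real assume e: "0 < e"
    obtain N where N: "inverse (real (Suc N)) < e\<^sup>2 / 8"
      using reals_Archimedean[of "e\<^sup>2 / 8"] e by auto
    have "dist (X i) (X j) < e" if "i \<ge> N" "j \<ge> N" for i j
    proof -
      have inv: "inverse (real (Suc n)) \<le> inverse (real (Suc N))" if "n \<ge> N" for n
        using that by (intro le_imp_inverse_le) auto
      have "(norm (X i - X j))\<^sup>2 / 4 < 2 * (e\<^sup>2 / 8)"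
        using para[of "X i" "X j"] X[of i] X[of j] inv[of i] inv[of j] that N by linarith
      then have "(norm (X i - X j))\<^sup>2 < e\<^sup>2" by simp
      then show ?thesis unfolding dist_norm by (rule power_less_imp_less_base) (use e in simp)
    qed
    then show "\<exists>N. \<forall>i\<ge>N. \<forall>j\<ge>N. dist (X i) (X j) < e" by blast
  qed
  then obtain z where z: "X \<longlonglongrightarrow> z" using Cauchy_convergent convergent_def by blast
  have "(\<lambda>n. J (X n)) \<longlonglongrightarrow> J z"
    unfolding J_def by (intro tendsto_intros f.tendsto z) simp
  moreover have "(\<lambda>n. m + inverse (real (Suc n))) \<longlonglongrightarrow> m + 0"
    by (intro tendsto_intros LIMSEQ_inverse_real_of_nat)
  ultimately have "J z \<le> m + 0"
    by (rule LIMSEQ_le) (intro exI allI impI less_imp_le[OF X])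
  then have Jz: "J z \<le> m" by simp
  have "f x = x \<bullet> z" for x
  proof (cases "x = 0")
    case False
    define d where "d = x \<bullet> z - f x"
    \<comment> \<open>The step that minimises \<open>J\<close> on the line through \<open>z\<close> in the direction \<open>x\<close>.\<close>
    define t where "t = - d / (x \<bullet> x)"
    have xx: "x \<bullet> x > 0" using False by simp
    have "(norm (z + t *\<^sub>R x))\<^sup>2 = (norm z)\<^sup>2 + 2 * (t * (x \<bullet> z)) + t * (t * (x \<bullet> x))"
      unfolding power2_norm_eq_inner
      by (simp add: inner_add_left inner_add_right inner_commute[of z x] algebra_simps)
    then have "J (z + t *\<^sub>R x) = J z + t * d + t * (t * (x \<bullet> x)) / 2"
      unfolding J_def f.add f.scaleR by (simp add: d_def algebra_simps add_divide_distrib)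
    moreover have "t * (x \<bullet> x) = - d" using xx by (simp add: t_def)
    ultimately have "J (z + t *\<^sub>R x) = J z + t * d / 2" by simp
    then have "0 \<le> t * d" using Jz m_le[of "z + t *\<^sub>R x"] by linarith
    then have "d * d \<le> 0" using xx by (simp add: t_def divide_le_0_iff)
    then have "d = 0" by (auto simp: mult_le_0_iff)
    then show ?thesis by (simp add: d_def)
  qed simp
  then show ?thesis by blast
qed

text \<open>
  The constant \<open>adjoint\<close> is a choice, which is meaningful only once some adjoint is known to
  exist. In infinite dimensions this is the representation theorem applied to
  \<open>\<lambda>x. B x \<bullet> y\<close>.
\<close>

lemma inner_adjoint_hilbert:
  fixes B :: "'a::{real_inner,banach} \<Rightarrow> 'b::real_inner"
  assumes "bounded_linear B"
  shows "B x \<bullet> y = x \<bullet> adjoint B y"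
proof -
  have "\<exists>z. \<forall>x. B x \<bullet> y = x \<bullet> z" for y
    by (rule riesz_representation)
      (intro bounded_linear_compose[OF bounded_linear_inner_left assms])
  then obtain f where f: "\<forall>x y. B x \<bullet> y = x \<bullet> f y" by metis
  then show ?thesis using adjoint_unique[OF f] by simp
qed

text \<open>
  This is \<open>\<parallel>B\<^sup>*\<parallel> \<le> \<parallel>B\<parallel>\<close>, which follows from \<open>\<parallel>B\<^sup>* y\<parallel>\<^sup>2 = B (B\<^sup>* y) \<bullet> y\<close>.
\<close>

lemma norm_compose_adjoint_diff_le:
  fixes B :: "'a::{real_inner,banach} \<Rightarrow> 'b::real_inner"
  assumes B: "bounded_linear B"
  shows "norm (B (adjoint B v) - B (adjoint B v')) \<le> (onorm B)\<^sup>2 * norm (v - v')"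
proof -
  interpret B: bounded_linear B by fact
  define z where "z = adjoint B v - adjoint B v'"
  have z: "B x \<bullet> (v - v') = x \<bullet> z" for x
    by (simp add: z_def inner_diff_right inner_adjoint_hilbert[OF B])
  have "norm z * norm z = B z \<bullet> (v - v')" by (simp add: z dot_square_norm power2_eq_square)
  also have "\<dots> \<le> norm (B z) * norm (v - v')" by (rule norm_cauchy_schwarz)
  also have "\<dots> \<le> (onorm B * norm z) * norm (v - v')"
    by (intro mult_right_mono onorm[OF B]) auto
  finally have "norm z \<le> onorm B * norm (v - v')"
    using onorm_pos_le[OF B] by (cases "z = 0") (auto simp: mult.assoc mult.left_commute)
  then have "onorm B * norm z \<le> onorm B * (onorm B * norm (v - v'))"
    using onorm_pos_le[OF B] by (rule mult_left_mono)
  moreover have "norm (B z) \<le> onorm B * norm z" by (rule onorm[OF B])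
  ultimately show ?thesis by (simp add: z_def B.diff power2_eq_square mult.assoc)
qed

section \<open>The delay and source operators on the phase space\<close>

text \<open>
  The integrand is dominated by \<open>\<mu> \<parallel>R w\<parallel>\<^sup>2 + \<mu> \<parallel>R w'\<parallel>\<^sup>2\<close>. Integrability is what allows the
  integral in \<open>phase_inner\<close> to be split when a square is expanded.
\<close>

lemma L2_mem_inner_integrable:
  assumes \<mu>: "memory_kernel \<mu>"
    and w: "w \<in> L2_mem V R \<mu>" and w': "w' \<in> L2_mem V R \<mu>"
  shows "(\<lambda>s. \<mu> s * (R (w s) \<bullet> R (w' s))) absolutely_integrable_on {0<..}"
proof -
  have cont: "continuous_on {0<..} \<mu>" and pos: "\<And>s. 0 < s \<Longrightarrow> 0 \<le> \<mu> s"
    using \<mu> by (auto simp: memory_kernel_def intro: continuous_on_subset)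
  let ?X = "\<lambda>s. indicator {0<..} s *\<^sub>R R (w s)" and ?Y = "\<lambda>s. indicator {0<..} s *\<^sub>R R (w' s)"
  let ?f = "\<lambda>s. indicator {0<..} s *\<^sub>R (\<mu> s * (norm (R (w s)))\<^sup>2)"
  let ?g = "\<lambda>s. indicator {0<..} s *\<^sub>R (\<mu> s * (norm (R (w' s)))\<^sup>2)"
  have m: "?X \<in> borel_measurable lebesgue" "?Y \<in> borel_measurable lebesgue"
    using w w' by (auto simp: L2_mem_def set_borel_measurable_def)
  have "(\<lambda>s. indicator {0<..} s *\<^sub>R \<mu> s) \<in> borel_measurable borel"
    using cont by (intro borel_measurable_continuous_on_indicator) auto
  then have \<mu>m: "(\<lambda>s. indicator {0<..} s *\<^sub>R \<mu> s) \<in> borel_measurable lebesgue"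
    by (auto intro: measurable_completion)
  have i: "integrable lebesgue ?f" "integrable lebesgue ?g"
    using w w' by (auto simp: L2_mem_def set_integrable_def)
  have eq: "(\<lambda>s. indicator {0<..} s *\<^sub>R (\<mu> s * (R (w s) \<bullet> R (w' s))))
      = (\<lambda>s. (indicator {0<..} s *\<^sub>R \<mu> s) * (?X s \<bullet> ?Y s))"
    by (auto split: split_indicator)
  have meas: "(\<lambda>s. indicator {0<..} s *\<^sub>R (\<mu> s * (R (w s) \<bullet> R (w' s)))) \<in> borel_measurable lebesgue"
    unfolding eq using m \<mu>m by (intro borel_measurable_times borel_measurable_inner)
  show ?thesis
    unfolding set_integrable_def
  proof (rule Bochner_Integration.integrable_bound[OF Bochner_Integration.integrable_add[OF i] meas])
    have "norm (\<mu> s * (x \<bullet> y)) \<le> norm (\<mu> s * (norm x)\<^sup>2 + \<mu> s * (norm y)\<^sup>2)" if "0 < s" for s and x y :: 'a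
    proof -
      have "\<bar>x \<bullet> y\<bar> \<le> norm x * norm y" by (rule Cauchy_Schwarz_ineq2)
      also have "\<dots> \<le> (norm x)\<^sup>2 + (norm y)\<^sup>2"
        using sum_squares_bound[of "norm x" "norm y"]
          mult_nonneg_nonneg[OF norm_ge_zero[of x] norm_ge_zero[of y]] by linarith
      finally have "\<mu> s * \<bar>x \<bullet> y\<bar> \<le> \<mu> s * ((norm x)\<^sup>2 + (norm y)\<^sup>2)"
        using pos[OF that] by (rule mult_left_mono)
      then show ?thesis using pos[OF that] by (simp add: abs_mult distrib_left)
    qed
    then show "AE s in lebesgue. norm (indicator {0<..} s *\<^sub>R (\<mu> s * (R (w s) \<bullet> R (w' s)))) \<le> norm (?f s + ?g s)"
      by (intro AE_I2) (auto split: split_indicator)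
  qed
qed

text \<open>
  Although \<open>Q\<close> is described only by inner products, these determine distances as well: expanding
  the square on the left gives three of them, and the weighted integrals combine into that of
  \<open>\<mu> \<parallel>R w - R w'\<parallel>\<^sup>2\<close>.
\<close>

lemma phase_space_dist:
  assumes Q: "phase_space V R \<mu> Q" and \<mu>: "memory_kernel \<mu>"
    and p: "(u, v, w) \<in> phase_reps V R \<mu>" and q: "(u', v', w') \<in> phase_reps V R \<mu>"
  shows "(norm (Q (u, v, w) - Q (u', v', w')))\<^sup>2
    = (1 - memory_mass \<mu>) * (norm (R u - R u'))\<^sup>2 + (norm (v - v'))\<^sup>2
      + (LINT s:{0<..}|lebesgue. \<mu> s * (norm (R (w s) - R (w' s)))\<^sup>2)"
proof -
  have w: "w \<in> L2_mem V R \<mu>" "w' \<in> L2_mem V R \<mu>"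
    using p q by (auto simp: phase_reps_def)
  note int = L2_mem_inner_integrable[OF \<mu>]
  let ?I = "\<lambda>w w'. LINT s:{0<..}|lebesgue. \<mu> s * (R (w s) \<bullet> R (w' s))"
  have "(LINT s:{0<..}|lebesgue. \<mu> s * (norm (R (w s) - R (w' s)))\<^sup>2)
      = (LINT s:{0<..}|lebesgue. \<mu> s * (R (w s) \<bullet> R (w s)) + \<mu> s * (R (w' s) \<bullet> R (w' s))
           - 2 * (\<mu> s * (R (w s) \<bullet> R (w' s))))"
    unfolding norm_diff_squared by (simp add: algebra_simps)
  also have "\<dots> = ?I w w + ?I w' w' - 2 * ?I w w'"
    using int[OF w(1) w(1)] int[OF w(2) w(2)] int[OF w(1) w(2)]
    by (simp add: set_integral_diff(2) set_integral_add set_integrable_mult_right)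
  finally have I: "(LINT s:{0<..}|lebesgue. \<mu> s * (norm (R (w s) - R (w' s)))\<^sup>2)
    = ?I w w + ?I w' w' - 2 * ?I w w'" .
  have inner: "Q a \<bullet> Q b = phase_inner R \<mu> a b" if "a \<in> phase_reps V R \<mu>" "b \<in> phase_reps V R \<mu>" for a b
    using Q that by (auto simp: phase_space_def)
  have "(norm (Q (u, v, w) - Q (u', v', w')))\<^sup>2
      = phase_inner R \<mu> (u, v, w) (u, v, w) + phase_inner R \<mu> (u', v', w') (u', v', w')
        - 2 * phase_inner R \<mu> (u, v, w) (u', v', w')"
    unfolding norm_diff_squared by (simp add: inner p q)
  then show ?thesis
    unfolding I norm_diff_squared[of v v'] norm_diff_squared[of "R u" "R u'"] phase_inner_def
    by (simp add: algebra_simps)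
qed

text \<open>
  All three terms of the squared distance are nonnegative, so each of them is bounded by it. In
  particular, \<open>R u\<close> and \<open>v\<close> depend only on the class of a triple.
\<close>

lemma phase_space_component_bounds:
  assumes Q: "phase_space V R \<mu> Q" and \<mu>: "memory_kernel \<mu>"
    and p: "(u, v, w) \<in> phase_reps V R \<mu>" and q: "(u', v', w') \<in> phase_reps V R \<mu>"
  shows "sqrt (1 - memory_mass \<mu>) * norm (R u - R u') \<le> norm (Q (u, v, w) - Q (u', v', w'))"
    and "norm (v - v') \<le> norm (Q (u, v, w) - Q (u', v', w'))"
proof -
  have c: "\<And>s. 0 < s \<Longrightarrow> 0 \<le> \<mu> s" "memory_mass \<mu> < 1"
    using \<mu> by (auto simp: memory_kernel_def)
  have "0 \<le> (LINT s:{0<..}|lebesgue. \<mu> s * (norm (R (w s) - R (w' s)))\<^sup>2)"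
    unfolding set_lebesgue_integral_def
    using c(1) by (intro Bochner_Integration.integral_nonneg) (auto split: split_indicator)
  then have *: "(1 - memory_mass \<mu>) * (norm (R u - R u'))\<^sup>2 \<le> (norm (Q (u, v, w) - Q (u', v', w')))\<^sup>2"
    "(norm (v - v'))\<^sup>2 \<le> (norm (Q (u, v, w) - Q (u', v', w')))\<^sup>2"
    unfolding phase_space_dist[OF Q \<mu> p q] using c(2) by auto
  show "sqrt (1 - memory_mass \<mu>) * norm (R u - R u') \<le> norm (Q (u, v, w) - Q (u', v', w'))"
  proof (rule power2_le_imp_le[OF _ norm_ge_zero])
    show "(sqrt (1 - memory_mass \<mu>) * norm (R u - R u'))\<^sup>2 \<le> (norm (Q (u, v, w) - Q (u', v', w')))\<^sup>2"
      using *(1) c(2) by (simp add: power_mult_distrib)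
  qed
  show "norm (v - v') \<le> norm (Q (u, v, w) - Q (u', v', w'))"
    using *(2) by (rule power2_le_imp_le) simp
qed

lemma sqrt_zero:
  assumes "is_sqrt_of V R D A"
  shows "0 \<in> V" "R 0 = 0"
proof -
  have l: "linear_map_on V R" using assms by (simp add: is_sqrt_of_def self_adjoint_on_def)
  then show V: "0 \<in> V" by (auto simp: linear_map_on_def subspace_0)
  have "R (0 *\<^sub>R 0) = 0 *\<^sub>R R 0" using l V unfolding linear_map_on_def by blast
  then show "R 0 = 0" by simp
qed

text \<open>
  Both \<open>\<B>\<close> and \<open>F\<close> take values in triples of this form.
\<close>

lemma velocity_in_phase_reps:
  assumes "is_sqrt_of V R D A"
  shows "(0, v, \<lambda>_. 0) \<in> phase_reps V R \<mu>"
  using sqrt_zero[OF assms] 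
  by (simp add: phase_reps_def L2_mem_def set_borel_measurable_def)

lemma norm_velocity_diff:
  assumes "phase_space V R \<mu> Q" "memory_kernel \<mu>" "is_sqrt_of V R D A"
  shows "norm (Q (0, v, \<lambda>_. 0) - Q (0, v', \<lambda>_. 0)) = norm (v - v')"
proof (rule power2_eq_imp_eq)
  show "(norm (Q (0, v, \<lambda>_. 0) - Q (0, v', \<lambda>_. 0)))\<^sup>2 = (norm (v - v'))\<^sup>2"
    unfolding phase_space_dist[OF assms(1,2) velocity_in_phase_reps[OF assms(3)]
        velocity_in_phase_reps[OF assms(3)]] by simp
qed simp_all

lemma phase_rep:
  assumes "phase_space V R \<mu> Q"
  obtains u v w where "inv_into (phase_reps V R \<mu>) Q X = (u, v, w)"
    "(u, v, w) \<in> phase_reps V R \<mu>" "Q (u, v, w) = X"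
proof -
  obtain u v w where uvw: "inv_into (phase_reps V R \<mu>) Q X = (u, v, w)" by (cases "inv_into (phase_reps V R \<mu>) Q X")
  have "X \<in> Q ` phase_reps V R \<mu>" using assms by (simp add: phase_space_def)
  from inv_into_into[OF this] f_inv_into_f[OF this] show ?thesis
    using that uvw by simp
qed

text \<open>
  \<open>\<B>\<close> only sees the velocity component, which is bounded by the norm of the phase space,
  and \<open>B B\<^sup>*\<close> contributes the factor \<open>b\<^sup>2\<close>.
\<close>

lemma delay_op_lipschitz:
  assumes Q: "phase_space V R \<mu> Q" and \<mu>: "memory_kernel \<mu>" and R: "is_sqrt_of V R D A"
    and B: "bounded_linear B"
  shows "norm (delay_op V R \<mu> Q B X - delay_op V R \<mu> Q B Y) \<le> (onorm B)\<^sup>2 * norm (X - Y)"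
proof -
  obtain u v w where X: "inv_into (phase_reps V R \<mu>) Q X = (u, v, w)"
    "(u, v, w) \<in> phase_reps V R \<mu>" "Q (u, v, w) = X" using phase_rep[OF Q] .
  obtain u' v' w' where Y: "inv_into (phase_reps V R \<mu>) Q Y = (u', v', w')"
    "(u', v', w') \<in> phase_reps V R \<mu>" "Q (u', v', w') = Y" using phase_rep[OF Q] .
  have "norm (delay_op V R \<mu> Q B X - delay_op V R \<mu> Q B Y) = norm (B (adjoint B v) - B (adjoint B v'))"
    by (simp add: delay_op_def X(1) Y(1) norm_velocity_diff[OF Q \<mu> R])
  also have "\<dots> \<le> (onorm B)\<^sup>2 * norm (v - v')" by (rule norm_compose_adjoint_diff_le[OF B])
  also have "\<dots> \<le> (onorm B)\<^sup>2 * norm (X - Y)"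
    using phase_space_component_bounds(2)[OF Q \<mu> X(2) Y(2)] X(3) Y(3) by (simp add: mult_left_mono)
  finally show ?thesis .
qed

lemma phase_space_zero:
  assumes Q: "phase_space V R \<mu> Q" and \<mu>: "memory_kernel \<mu>" and R: "is_sqrt_of V R D A"
  shows "Q (0, 0, \<lambda>_. 0) = 0"
proof -
  have "Q (0, 0, \<lambda>_. 0) \<bullet> Q (0, 0, \<lambda>_. 0) = 0"
    using Q velocity_in_phase_reps[OF R, of 0 \<mu>] sqrt_zero[OF R]
    by (simp add: phase_space_def phase_inner_def)
  then show ?thesis by simp
qed

text \<open>
  \<open>R u = 0\<close> puts \<open>u\<close> into the domain of \<open>A = R\<^sup>2\<close>, and \<open>A\<close> is injective.
\<close>

lemma sqrt_injective_at_zero: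
  assumes A: "has_compact_inverse D A" and R: "is_sqrt_of V R D A"
    and u: "u \<in> V" "R u = 0"
  shows "u = 0"
proof -
  have V: "D = {x \<in> V. R x \<in> V}" "\<And>x. x \<in> D \<Longrightarrow> R (R x) = A x"
    using R by (auto simp: is_sqrt_of_def)
  have D: "u \<in> D" "0 \<in> D" using V(1) u sqrt_zero[OF R] by auto
  then have "A u = A 0" using V(2)[of u] V(2)[of 0] u sqrt_zero[OF R] by simp
  moreover have "inj_on A D" using A by (simp add: has_compact_inverse_def bij_betw_def)
  ultimately show ?thesis using D by (auto dest: inj_onD)
qed

lemma phase_rep_zero:
  assumes Q: "phase_space V R \<mu> Q" and \<mu>: "memory_kernel \<mu>"
    and A: "has_compact_inverse D A" and R: "is_sqrt_of V R D A"
  obtains w where "inv_into (phase_reps V R \<mu>) Q 0 = (0, 0, w)"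
proof -
  obtain u v w where p: "inv_into (phase_reps V R \<mu>) Q 0 = (u, v, w)"
    "(u, v, w) \<in> phase_reps V R \<mu>" "Q (u, v, w) = 0" using phase_rep[OF Q] .
  note bounds = phase_space_component_bounds[OF Q \<mu> p(2) velocity_in_phase_reps[OF R, of 0]]
  have "memory_mass \<mu> < 1" using \<mu> by (simp add: memory_kernel_def)
  then have "R u = 0"
    using bounds(1) p(3) phase_space_zero[OF Q \<mu> R] sqrt_zero[OF R] by (simp add: mult_le_0_iff)
  moreover have "u \<in> V" using p(2) by (simp add: phase_reps_def)
  ultimately have "u = 0" by (rule sqrt_injective_at_zero[OF A R, rotated])
  moreover have "v = 0" using bounds(2) p(3) phase_space_zero[OF Q \<mu> R] by simp
  ultimately show ?thesis using that p(1) by simp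
qed

lemma delay_op_zero:
  assumes "phase_space V R \<mu> Q" "memory_kernel \<mu>"
    "has_compact_inverse D A" "is_sqrt_of V R D A" and B: "bounded_linear B"
  shows "delay_op V R \<mu> Q B 0 = 0"
proof -
  have "adjoint B 0 = 0" using inner_adjoint_hilbert[OF B, of "adjoint B 0" 0] by simp
  moreover obtain w where "inv_into (phase_reps V R \<mu>) Q 0 = (0, 0, w)"
    using phase_rep_zero[OF assms(1-4)] .
  ultimately show ?thesis
    by (simp add: delay_op_def linear_simps(3)[OF B] phase_space_zero[OF assms(1,2,4)])
qed

lemma source_map_zero:
  assumes "phase_space V R \<mu> Q" "memory_kernel \<mu>"
    "has_compact_inverse D A" "is_sqrt_of V R D A" and G: "G 0 = 0"
  shows "source_map V R \<mu> Q G 0 = 0"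
proof -
  obtain w where "inv_into (phase_reps V R \<mu>) Q 0 = (0, 0, w)"
    using phase_rep_zero[OF assms(1-4)] .
  then show ?thesis
    by (simp add: source_map_def G phase_space_zero[OF assms(1,2,4)])
qed

section \<open>Continuous dependence of mild solutions on the data\<close>

lemma absolutely_integrable_continuous_mult:
  fixes f k :: "real \<Rightarrow> real"
  assumes "continuous_on {a..b} f" "k absolutely_integrable_on {a..b}"
  shows "(\<lambda>s. f s * k s) absolutely_integrable_on {a..b}"
  using assms by (intro absolutely_integrable_bounded_measurable_product_real)
    (auto intro!: continuous_imp_measurable_on_sets_lebesgue compact_imp_bounded
      compact_continuous_image)

lemma absolutely_integrable_shift:
  fixes f :: "real \<Rightarrow> real"
  assumes "f absolutely_integrable_on {a..b}"
  shows "(\<lambda>s. f (s + c)) absolutely_integrable_on {a - c..b - c}"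
  using assms integrable_shift_real_ivl[of f a b c] integrable_shift_real_ivl[of "\<lambda>s. \<bar>f s\<bar>" a b c]
  by (simp add: absolutely_integrable_on_def)

text \<open>
  The integrand switches at \<open>\<tau>\<close> from the prescribed history \<open>d\<close> to the delayed value of \<open>w\<close>.
  Enlarging the domain to \<open>[0, t + \<tau>]\<close>, which only adds a nonnegative amount, avoids the case
  distinction between \<open>t \<le> \<tau>\<close> and \<open>t > \<tau>\<close>. The part after \<open>\<tau>\<close> is then shifted back by \<open>\<tau>\<close>,
  and the delay disappears from \<open>w\<close> and moves into the coefficient \<open>\<kappa>\<close>.
\<close>

lemma delayed_term_bound:
  fixes \<kappa> d w :: "real \<Rightarrow> real"
  assumes \<tau>: "0 \<le> \<tau>" and t: "0 \<le> t"
    and \<kappa>: "\<And>T. \<kappa> absolutely_integrable_on {0..T}" "\<And>s. 0 \<le> \<kappa> s"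
    and d: "continuous_on {0..\<tau>} d" "\<And>s. 0 \<le> d s"
    and w: "continuous_on {0..t} w" "\<And>s. 0 \<le> w s"
  shows "(\<lambda>s. (if s \<le> \<tau> then d s else w (s - \<tau>)) * \<kappa> s) absolutely_integrable_on {0..t}"
    and "integral {0..t} (\<lambda>s. (if s \<le> \<tau> then d s else w (s - \<tau>)) * \<kappa> s)
      \<le> integral {0..\<tau>} (\<lambda>s. d s * \<kappa> s) + integral {0..t} (\<lambda>s. w s * \<kappa> (s + \<tau>))"
proof -
  let ?m = "\<lambda>s. if s \<le> \<tau> then d s else w (s - \<tau>)"
  have \<kappa>_sub: "\<kappa> absolutely_integrable_on {a..b}" if "0 \<le> a" for a b
    using absolutely_integrable_on_subinterval[OF \<kappa>(1)[of b], of a b] that by auto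
  have first: "(\<lambda>s. d s * \<kappa> s) absolutely_integrable_on {0..\<tau>}"
    by (rule absolutely_integrable_continuous_mult[OF d(1) \<kappa>(1)])
  have first': "(\<lambda>s. ?m s * \<kappa> s) absolutely_integrable_on {0..\<tau>}"
    using first by (rule absolutely_integrable_spike[of _ _ "{}"]) auto
  have second: "(\<lambda>s. w (s - \<tau>) * \<kappa> s) absolutely_integrable_on {\<tau>..t + \<tau>}"
  proof (rule absolutely_integrable_continuous_mult)
    show "continuous_on {\<tau>..t + \<tau>} (\<lambda>s. w (s - \<tau>))"
      by (rule continuous_on_compose2[OF w(1)]) (auto intro!: continuous_intros)
  qed (use \<kappa>_sub \<tau> in auto)
  have second': "(\<lambda>s. ?m s * \<kappa> s) absolutely_integrable_on {\<tau>..t + \<tau>}"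
    using second by (rule absolutely_integrable_spike[of _ _ "{\<tau>}"]) auto
  have all: "(\<lambda>s. ?m s * \<kappa> s) absolutely_integrable_on {0..t + \<tau>}"
    using absolutely_integrable_on_combine[OF first' second'] \<tau> t by auto
  show "(\<lambda>s. ?m s * \<kappa> s) absolutely_integrable_on {0..t}"
    by (rule absolutely_integrable_on_subinterval[OF all]) (use \<tau> in auto)
  note int = set_lebesgue_integral_eq_integral(1)
  have "integral {0..t} (\<lambda>s. ?m s * \<kappa> s) \<le> integral {0..t + \<tau>} (\<lambda>s. ?m s * \<kappa> s)"
  proof (rule integral_subset_le)
    show "(\<lambda>s. ?m s * \<kappa> s) integrable_on {0..t}"
      by (rule integrable_on_subinterval[OF int[OF all]]) (use \<tau> in auto)
  qed (use \<tau> int[OF all] d(2) w(2) \<kappa>(2) in auto)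
  also have "\<dots> = integral {0..\<tau>} (\<lambda>s. ?m s * \<kappa> s) + integral {\<tau>..t + \<tau>} (\<lambda>s. ?m s * \<kappa> s)"
    by (rule Henstock_Kurzweil_Integration.integral_combine[symmetric]) (use \<tau> t int[OF all] in auto)
  also have "integral {0..\<tau>} (\<lambda>s. ?m s * \<kappa> s) = integral {0..\<tau>} (\<lambda>s. d s * \<kappa> s)"
    by (rule integral_cong) auto
  also have "integral {\<tau>..t + \<tau>} (\<lambda>s. ?m s * \<kappa> s) = integral {\<tau>..t + \<tau>} (\<lambda>s. w (s - \<tau>) * \<kappa> s)"
    by (rule integral_spike[of "{\<tau>}"]) auto
  also have "\<dots> = integral {0..t} (\<lambda>s. w s * \<kappa> (s + \<tau>))"
    using integral_shift_real_ivl[where f = "\<lambda>s. w (s - \<tau>) * \<kappa> s" and c = \<tau> and a = \<tau> and b = "t + \<tau>"]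
    by simp
  finally show "integral {0..t} (\<lambda>s. ?m s * \<kappa> s)
    \<le> integral {0..\<tau>} (\<lambda>s. d s * \<kappa> s) + integral {0..t} (\<lambda>s. w s * \<kappa> (s + \<tau>))" .
qed

text \<open>
  Continuous dependence on the data with an explicit rate, for solutions that stay in a ball on
  which \<open>F\<close> has Lipschitz constant \<open>l\<close>. After multiplication by \<open>exp (\<omega> t)\<close> the decay of the
  semigroup cancels in the difference of the two variation-of-constants formulas. Writing
  \<open>v t = exp (\<omega> t) \<parallel>U t - U' t\<parallel>\<close>, the delayed term becomes
  \<open>\<beta> exp (\<omega> \<tau>) \<bar>k (s + \<tau>)\<bar> v s\<close>, where \<open>exp (\<omega> \<tau>)\<close> is the price of the shift of the weight, and
  Gronwall's inequality applies.
\<close>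

lemma mild_solution_stability:
  fixes S :: "real \<Rightarrow> 'x::{banach,second_countable_topology} \<Rightarrow> 'x"
  assumes S: "\<And>t. 0 \<le> t \<Longrightarrow> bounded_linear (S t)"
      "\<And>t. 0 \<le> t \<Longrightarrow> onorm (S t) \<le> M * exp (- \<omega> * t)"
    and k: "\<And>T. 0 < T \<Longrightarrow> k absolutely_integrable_on {0..T}"
    and \<tau>: "0 \<le> \<tau>" and M: "0 \<le> M" and \<beta>: "0 \<le> \<beta>" and l: "0 \<le> l"
    and \<B>: "\<And>X Y. norm (\<B> X - \<B> Y) \<le> \<beta> * norm (X - Y)"
    and F: "\<And>X Y. norm X \<le> r \<Longrightarrow> norm Y \<le> r \<Longrightarrow> norm (F X - F Y) \<le> l * norm (X - Y)"
    and U: "mild_solution S k \<B> F \<tau> U0 g U" and U': "mild_solution S k \<B> F \<tau> U0' g' U'"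
    and g: "continuous_on {0..\<tau>} g" "continuous_on {0..\<tau>} g'"
    and T: "0 \<le> T"
    and bound: "\<And>t. t \<in> {0..T} \<Longrightarrow> norm (U t) \<le> r" "\<And>t. t \<in> {0..T} \<Longrightarrow> norm (U' t) \<le> r"
  shows "norm (U T - U' T) \<le> M *
      (norm (U0 - U0') + (LINT s:{0..\<tau>}|lebesgue. exp (\<omega> * s) * \<bar>k s\<bar> * norm (g s - g' s))) *
      exp (\<beta> * M * exp (\<omega> * \<tau>) * (LINT s:{0..T}|lebesgue. \<bar>k (s + \<tau>)\<bar>) + M * l * T - \<omega> * T)"
proof -
  define \<delta> where "\<delta> s = norm (U s - U' s)" for s
  define v where "v s = exp (\<omega> * s) * \<delta> s" for s
  define d where "d s = norm (g s - g' s)" for s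
  define \<kappa> where "\<kappa> s = exp (\<omega> * s) * \<bar>k s\<bar>" for s
  define c where "c = M * (norm (U0 - U0') + integral {0..\<tau>} (\<lambda>s. d s * \<kappa> s))"
  define a where "a s = M * \<beta> * exp (\<omega> * \<tau>) * \<bar>k (s + \<tau>)\<bar> + M * l" for s
  note int = set_lebesgue_integral_eq_integral(1)
  have k_all: "k absolutely_integrable_on {0..x}" for x
    using absolutely_integrable_on_subinterval[OF k[of "max x 1"], of 0 x] by auto
  have abs_k: "(\<lambda>s. \<bar>k s\<bar>) absolutely_integrable_on {0..x}" for x
    by (rule absolutely_integrable_abs[OF k_all, simplified])
  have \<kappa>: "\<kappa> absolutely_integrable_on {0..x}" for x
    unfolding \<kappa>_def by (intro absolutely_integrable_continuous_mult abs_k continuous_intros)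
  have k_shift: "(\<lambda>s. \<bar>k (s + \<tau>)\<bar>) absolutely_integrable_on {0..x}" for x
    using absolutely_integrable_shift[OF absolutely_integrable_on_subinterval[OF abs_k[of "x + \<tau>"], of \<tau> "x + \<tau>"], of \<tau>] \<tau>
    by auto
  have Ucont: "continuous_on {0..} U" "continuous_on {0..} U'"
    using U U' by (auto simp: mild_solution_def)
  have \<delta>: "continuous_on {0..t} \<delta>" for t
    unfolding \<delta>_def by (intro continuous_intros continuous_on_subset[OF Ucont(1)] continuous_on_subset[OF Ucont(2)]) auto
  then have v: "continuous_on {0..t} v" for t
    unfolding v_def by (intro continuous_intros)
  have d: "continuous_on {0..\<tau>} d"
    unfolding d_def by (intro continuous_intros g)
  have S_le: "norm (S t x) \<le> M * exp (- \<omega> * t) * norm x" if "0 \<le> t" for t x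
    using onorm[OF S(1)[OF that], of x] mult_right_mono[OF S(2)[OF that], of "norm x"] by simp
  have v_le: "v t \<le> c + integral {0..t} (\<lambda>s. a s * v s)" if t: "t \<in> {0..T}" for t
  proof -
    have t0: "0 \<le> t" using t by simp
    define f where "f s = S (t - s) (- k s *\<^sub>R (if s \<le> \<tau> then g s else \<B> (U (s - \<tau>))) + F (U s))" for s
    define f' where "f' s = S (t - s) (- k s *\<^sub>R (if s \<le> \<tau> then g' s else \<B> (U' (s - \<tau>))) + F (U' s))" for s
    define m where "m s = (if s \<le> \<tau> then d s else \<beta> * \<delta> (s - \<tau>))" for s
    have f: "f absolutely_integrable_on {0..t}" "U t = S t U0 + (LINT s:{0..t}|lebesgue. f s)"
      using U t0 unfolding mild_solution_def f_def[abs_def] Let_def by blast+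
    have f': "f' absolutely_integrable_on {0..t}" "U' t = S t U0' + (LINT s:{0..t}|lebesgue. f' s)"
      using U' t0 unfolding mild_solution_def f'_def[abs_def] Let_def by blast+
    have f_le: "norm (f s - f' s) \<le> exp (- \<omega> * t) * (M * (m s * \<kappa> s + l * v s))" if s: "s \<in> {0..t}" for s
    proof -
      define p where "p = - k s *\<^sub>R (if s \<le> \<tau> then g s else \<B> (U (s - \<tau>))) + F (U s)"
      define p' where "p' = - k s *\<^sub>R (if s \<le> \<tau> then g' s else \<B> (U' (s - \<tau>))) + F (U' s)"
      have "p - p' = - k s *\<^sub>R ((if s \<le> \<tau> then g s else \<B> (U (s - \<tau>))) - (if s \<le> \<tau> then g' s else \<B> (U' (s - \<tau>))))
          + (F (U s) - F (U' s))"
        unfolding p_def p'_def by (simp add: algebra_simps)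
      also have "norm \<dots> \<le> \<bar>k s\<bar> * norm ((if s \<le> \<tau> then g s else \<B> (U (s - \<tau>))) - (if s \<le> \<tau> then g' s else \<B> (U' (s - \<tau>))))
          + norm (F (U s) - F (U' s))"
        by (rule order_trans[OF norm_triangle_ineq]) simp
      also have "\<dots> \<le> \<bar>k s\<bar> * m s + l * \<delta> s"
        unfolding m_def d_def \<delta>_def using s t by (intro add_mono mult_left_mono F \<B> bound) (auto intro: \<B>)
      finally have p: "norm (p - p') \<le> \<bar>k s\<bar> * m s + l * \<delta> s" .
      have "f s - f' s = S (t - s) (p - p')"
        using linear_simps(2)[OF S(1)[of "t - s"]] s by (simp add: f_def f'_def p_def p'_def)
      then have "norm (f s - f' s) \<le> M * exp (- \<omega> * (t - s)) * norm (p - p')"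
        using S_le[of "t - s" "p - p'"] s by simp
      also have "\<dots> \<le> M * exp (- \<omega> * (t - s)) * (\<bar>k s\<bar> * m s + l * \<delta> s)"
        by (rule mult_left_mono[OF p]) (use M in simp)
      also have "exp (- \<omega> * (t - s)) = exp (- \<omega> * t) * exp (\<omega> * s)"
        by (simp add: exp_add[symmetric] algebra_simps)
      finally show ?thesis by (simp add: \<kappa>_def v_def algebra_simps)
    qed
    \<comment> \<open>The weighted coefficient \<open>\<kappa>\<close> is used so that the history term keeps its factor
      \<open>exp (\<omega> s)\<close>, while the delayed term still has the unweighted difference \<open>\<delta>\<close>.\<close>
    have \<beta>\<delta>: "continuous_on {0..t} (\<lambda>s. \<beta> * \<delta> s)" by (intro continuous_intros \<delta>)
    have m: "(\<lambda>s. m s * \<kappa> s) absolutely_integrable_on {0..t}"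
        "integral {0..t} (\<lambda>s. m s * \<kappa> s)
          \<le> integral {0..\<tau>} (\<lambda>s. d s * \<kappa> s) + integral {0..t} (\<lambda>s. \<beta> * \<delta> s * \<kappa> (s + \<tau>))"
      unfolding m_def using delayed_term_bound[OF \<tau> t0 \<kappa> _ d _ \<beta>\<delta>] \<beta> by (auto simp: \<kappa>_def d_def \<delta>_def)
    have lv: "(\<lambda>s. l * v s) absolutely_integrable_on {0..t}"
      by (intro absolutely_integrable_continuous_real continuous_intros v)
    have rhs: "(\<lambda>s. exp (- \<omega> * t) * (M * (m s * \<kappa> s + l * v s))) absolutely_integrable_on {0..t}"
      by (intro set_integrable_mult_right set_integral_add(1) m(1) lv)
    have delayed: "(\<lambda>s. \<beta> * \<delta> s * \<kappa> (s + \<tau>)) = (\<lambda>s. \<beta> * exp (\<omega> * \<tau>) * \<bar>k (s + \<tau>)\<bar> * v s)"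
      by (simp add: fun_eq_iff \<kappa>_def v_def exp_add distrib_left)
    have kv: "(\<lambda>s. v s * \<bar>k (s + \<tau>)\<bar>) absolutely_integrable_on {0..t}"
      by (rule absolutely_integrable_continuous_mult[OF v k_shift])
    then have kv': "(\<lambda>s. \<beta> * exp (\<omega> * \<tau>) * \<bar>k (s + \<tau>)\<bar> * v s) integrable_on {0..t}"
      using integrable_on_mult_right[OF int[OF kv], of "\<beta> * exp (\<omega> * \<tau>)"] by (simp add: mult_ac)
    have "U t - U' t = S t (U0 - U0') + (LINT s:{0..t}|lebesgue. f s - f' s)"
      using set_integral_diff(2)[OF f(1) f'(1)] linear_simps(2)[OF S(1)[OF t0]]
      by (simp add: f(2) f'(2))
    then have "\<delta> t \<le> norm (S t (U0 - U0')) + norm (LINT s:{0..t}|lebesgue. f s - f' s)"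
      unfolding \<delta>_def by (simp add: norm_triangle_ineq)
    also have "norm (LINT s:{0..t}|lebesgue. f s - f' s) \<le> (LINT s:{0..t}|lebesgue. norm (f s - f' s))"
      by (rule set_integral_norm_bound[OF set_integral_diff(1)[OF f(1) f'(1)]])
    also have "\<dots> \<le> (LINT s:{0..t}|lebesgue. exp (- \<omega> * t) * (M * (m s * \<kappa> s + l * v s)))"
      by (rule set_integral_mono[OF set_integrable_norm[OF set_integral_diff(1)[OF f(1) f'(1)]] rhs f_le])
    also have "\<dots> = exp (- \<omega> * t) * (M * (integral {0..t} (\<lambda>s. m s * \<kappa> s) + integral {0..t} (\<lambda>s. l * v s)))"
      unfolding set_lebesgue_integral_eq_integral(2)[OF rhs] integral_mult_right
        Henstock_Kurzweil_Integration.integral_add[OF int[OF m(1)] int[OF lv]] ..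
    also have "norm (S t (U0 - U0')) \<le> exp (- \<omega> * t) * (M * norm (U0 - U0'))"
      using S_le[OF t0, of "U0 - U0'"] by (simp add: mult_ac)
    finally have "\<delta> t \<le> exp (- \<omega> * t) *
        (M * (norm (U0 - U0') + integral {0..t} (\<lambda>s. m s * \<kappa> s) + integral {0..t} (\<lambda>s. l * v s)))"
      by (simp add: algebra_simps)
    then have "v t \<le> exp (\<omega> * t) * (exp (- \<omega> * t) *
        (M * (norm (U0 - U0') + integral {0..t} (\<lambda>s. m s * \<kappa> s) + integral {0..t} (\<lambda>s. l * v s))))"
      unfolding v_def by (rule mult_left_mono) simp
    also have "\<dots> = M * (norm (U0 - U0') + integral {0..t} (\<lambda>s. m s * \<kappa> s) + integral {0..t} (\<lambda>s. l * v s))"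
      by (simp add: exp_minus)
    also have "\<dots> \<le> M * (norm (U0 - U0') + (integral {0..\<tau>} (\<lambda>s. d s * \<kappa> s)
        + integral {0..t} (\<lambda>s. \<beta> * \<delta> s * \<kappa> (s + \<tau>))) + integral {0..t} (\<lambda>s. l * v s))"
      using m(2) M by (intro mult_left_mono add_mono) auto
    also have "\<dots> = c + M * integral {0..t} (\<lambda>s. \<beta> * exp (\<omega> * \<tau>) * \<bar>k (s + \<tau>)\<bar> * v s + l * v s)"
      unfolding c_def delayed Henstock_Kurzweil_Integration.integral_add[OF kv' int[OF lv]]
      by (simp only: algebra_simps)
    also have "M * integral {0..t} (\<lambda>s. \<beta> * exp (\<omega> * \<tau>) * \<bar>k (s + \<tau>)\<bar> * v s + l * v s)
        = integral {0..t} (\<lambda>s. a s * v s)"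
      unfolding integral_mult_right[symmetric] a_def by (simp add: algebra_simps)
    finally show ?thesis .
  qed
  have ak: "(\<lambda>s. M * \<beta> * exp (\<omega> * \<tau>) * \<bar>k (s + \<tau>)\<bar>) absolutely_integrable_on {0..T}"
    by (intro set_integrable_mult_right k_shift)
  have const: "(\<lambda>s. M * l) absolutely_integrable_on {0..T}"
    by (intro absolutely_integrable_continuous_real continuous_intros)
  have "v T \<le> c * exp (integral {0..T} a)"
  proof (rule gronwall_integrable_kernel[OF T _ _ v _ v_le])
    show "a absolutely_integrable_on {0..T}"
      unfolding a_def by (rule set_integral_add(1)[OF ak const])
  qed (use M \<beta> l in \<open>auto simp: a_def v_def \<delta>_def\<close>)
  also have "integral {0..T} a = \<beta> * M * exp (\<omega> * \<tau>) * (LINT s:{0..T}|lebesgue. \<bar>k (s + \<tau>)\<bar>) + M * l * T"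
    unfolding a_def Henstock_Kurzweil_Integration.integral_add[OF int[OF ak] int[OF const]]
    using T by (simp add: set_lebesgue_integral_eq_integral(2)[OF k_shift])
  finally have "exp (- \<omega> * T) * v T \<le> exp (- \<omega> * T) * (c * exp (\<beta> * M * exp (\<omega> * \<tau>) *
      (LINT s:{0..T}|lebesgue. \<bar>k (s + \<tau>)\<bar>) + M * l * T))"
    by (rule mult_left_mono) simp
  moreover have "exp (- \<omega> * T) * v T = norm (U T - U' T)"
    by (simp add: v_def \<delta>_def exp_minus)
  moreover have "c = M * (norm (U0 - U0') + (LINT s:{0..\<tau>}|lebesgue. exp (\<omega> * s) * \<bar>k s\<bar> * norm (g s - g' s)))"
    using set_lebesgue_integral_eq_integral(2)[OF absolutely_integrable_continuous_mult[OF d \<kappa>]]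
    by (simp add: c_def \<kappa>_def d_def mult_ac)
  ultimately show ?thesis by (simp add: exp_diff exp_minus field_simps)
qed

text \<open>
  The delay equation is not linear, but its nonlinearities vanish at the origin, so the
  equilibrium \<open>0\<close> is a solution with which any other one can be compared.
\<close>

lemma mild_solution_zero:
  assumes S: "\<And>t. 0 \<le> t \<Longrightarrow> bounded_linear (S t)" and "\<B> 0 = 0" "F 0 = 0"
  shows "mild_solution S k \<B> F \<tau> 0 (\<lambda>_. 0) (\<lambda>_. 0)"
proof -
  have zero: "S (t - s) (- k s *\<^sub>R (if s \<le> \<tau> then 0 else \<B> 0) + F 0) = 0" if "s \<in> {0..t}" for s t
    using linear_simps(3)[OF S[of "t - s"]] that assms(2,3) by simp
  have "(\<lambda>s. S (t - s) (- k s *\<^sub>R (if s \<le> \<tau> then 0 else \<B> 0) + F 0)) absolutely_integrable_on {0..t}" for t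
    by (subst set_integrable_cong[OF refl refl zero]) auto
  moreover have "(LINT s:{0..t}|lebesgue. S (t - s) (- k s *\<^sub>R (if s \<le> \<tau> then 0 else \<B> 0) + F 0))
      = (LINT s:{0..t}|lebesgue. 0)" for t
    by (rule set_lebesgue_integral_cong, simp) (intro allI impI zero)
  ultimately show ?thesis
    using linear_simps(3)[OF S] by (simp add: mild_solution_def Let_def set_lebesgue_integral_def)
qed

section \<open>Exponential decay\<close>

theorem theorem3p1:
  fixes A R B G :: "'h::{real_inner,banach,second_countable_topology} \<Rightarrow> 'h"
    and D V :: "'h set"
    and \<psi> :: "'h \<Rightarrow> real" and D\<psi> :: "'h \<Rightarrow> 'h \<Rightarrow> real"
    and \<mu> k L :: "real \<Rightarrow> real"
    and Q :: "'h \<times> 'h \<times> (real \<Rightarrow> 'h) \<Rightarrow> 'x::{real_inner,banach,second_countable_topology}"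
    and S :: "real \<Rightarrow> 'x \<Rightarrow> 'x" and \<B> F :: "'x \<Rightarrow> 'x"
    and \<tau> M \<omega> \<omega>' \<gamma> \<rho> C\<rho> :: real
  assumes A: "self_adjoint_on D A" "positive_on D A" "has_compact_inverse D A"
    and R: "is_sqrt_of V R D A"
    and \<tau>: "0 < \<tau>"
    and B: "bounded_linear B"
    and k: "delay_coefficient \<tau> k"
    and \<mu>: "memory_kernel \<mu>"
    and \<psi>: "admissible_potential V R \<psi> D\<psi> G"
    and Q: "phase_space V R \<mu> Q"
    and S: "generated_by S (generator_A D A V R \<mu> Q)"
    and \<B>_eq: "\<B> = delay_op V R \<mu> Q B"
    and F_eq: "F = source_map V R \<mu> Q G"
    and L: "lipschitz_constants F L"
    and M: "0 < M" "0 < \<omega>" "\<forall>t\<ge>0. onorm (S t) \<le> M * exp (- \<omega> * t)"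
    and \<omega>': "0 \<le> \<omega>'" "\<omega>' < \<omega>"
    and k_growth: "\<forall>t\<ge>0. (onorm B)\<^sup>2 * M * exp (\<omega> * \<tau>) * (LINT s:{0..t}|lebesgue. \<bar>k (s + \<tau>)\<bar>)
                     \<le> \<gamma> + \<omega>' * t"
    and W: "0 < \<rho>" "0 < C\<rho>" "L C\<rho> < (\<omega> - \<omega>') / M"
      "\<forall>U0 g. small_data k \<tau> \<rho> U0 g \<longrightarrow>
         (\<exists>U. mild_solution S k \<B> F \<tau> U0 g U \<and> (\<forall>t>0. norm (U t) \<le> C\<rho>)
            \<and> (\<forall>U'. mild_solution S k \<B> F \<tau> U0 g U' \<and> (\<forall>t>0. norm (U' t) \<le> C\<rho>)
                 \<longrightarrow> (\<forall>t\<ge>0. U' t = U t)))"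
  shows "\<forall>U0 g U. small_data k \<tau> \<rho> U0 g \<longrightarrow> mild_solution S k \<B> F \<tau> U0 g U \<longrightarrow>
           (\<forall>t\<ge>0. norm (U t) \<le> M * exp \<gamma>
              * (norm U0 + (LINT s:{0..\<tau>}|lebesgue. exp (\<omega> * s) * \<bar>k s\<bar> * norm (g s)))
              * exp (- (\<omega> - \<omega>' - M * L C\<rho>) * t))"
proof (intro allI impI)
  fix U0 :: 'x and g U :: "real \<Rightarrow> 'x" and t :: real
  assume small: "small_data k \<tau> \<rho> U0 g" and U: "mild_solution S k \<B> F \<tau> U0 g U" and t: "0 \<le> t"
  have Slin: "\<And>t. 0 \<le> t \<Longrightarrow> bounded_linear (S t)" and Sbd: "\<And>t. 0 \<le> t \<Longrightarrow> onorm (S t) \<le> M * exp (- \<omega> * t)"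
    using S M by (auto simp: generated_by_def c0_semigroup_def)
  have k_int: "\<And>T. 0 < T \<Longrightarrow> k absolutely_integrable_on {0..T}"
    using k by (auto simp: delay_coefficient_def)
  have g: "continuous_on {0..\<tau>} g" using small by (simp add: small_data_def)
  have \<B>: "norm (\<B> X - \<B> Y) \<le> (onorm B)\<^sup>2 * norm (X - Y)" for X Y
    unfolding \<B>_eq by (rule delay_op_lipschitz[OF Q \<mu> R B])
  have F: "norm (F X - F Y) \<le> L r * norm (X - Y)"
    if "0 < r" "norm X \<le> r" "norm Y \<le> r" for r X Y
    using L that by (auto simp: lipschitz_constants_def)
  have L_pos: "0 \<le> L r" if "0 < r" for r
    using L that by (auto simp: lipschitz_constants_def intro: less_imp_le)
  have "\<B> 0 = 0" unfolding \<B>_eq by (rule delay_op_zero[OF Q \<mu> A(3) R B])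
  moreover have "F 0 = 0"
    unfolding F_eq by (rule source_map_zero[OF Q \<mu> A(3) R]) (use \<psi> in \<open>simp add: admissible_potential_def\<close>)
  ultimately have zero: "mild_solution S k \<B> F \<tau> 0 (\<lambda>_. 0) (\<lambda>_. 0)"
    by (intro mild_solution_zero Slin)
  have stable: "norm (X T - X' T) \<le> M *
      (norm (x - x') + (LINT s:{0..\<tau>}|lebesgue. exp (\<omega> * s) * \<bar>k s\<bar> * norm (h s - h' s))) *
      exp ((onorm B)\<^sup>2 * M * exp (\<omega> * \<tau>) * (LINT s:{0..T}|lebesgue. \<bar>k (s + \<tau>)\<bar>) + M * L r * T - \<omega> * T)"
    if "0 < r" "0 \<le> T" "mild_solution S k \<B> F \<tau> x h X" "mild_solution S k \<B> F \<tau> x' h' X'"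
      "continuous_on {0..\<tau>} h" "continuous_on {0..\<tau>} h'"
      "\<And>t. t \<in> {0..T} \<Longrightarrow> norm (X t) \<le> r" "\<And>t. t \<in> {0..T} \<Longrightarrow> norm (X' t) \<le> r"
    for r T x x' h h' X X'
    by (rule mild_solution_stability[OF Slin Sbd k_int less_imp_le[OF \<tau>] less_imp_le[OF M(1)]
          zero_le_power2 L_pos[OF that(1)] \<B> F[OF that(1)] that(3-6,2,7,8)])
  obtain W where W_sol: "mild_solution S k \<B> F \<tau> U0 g W" and W_le: "\<And>t. 0 < t \<Longrightarrow> norm (W t) \<le> C\<rho>"
    using W(4) small by blast
  have cont: "continuous_on {0..} U" "continuous_on {0..} W"
    using U W_sol by (auto simp: mild_solution_def)
  have W_le': "norm (W s) \<le> C\<rho>" if "s \<in> {0..t}" for s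
    using continuous_on_closure_norm_le[of "{0<..}" W C\<rho> s] cont(2) W_le that by simp
  \<comment> \<open>Uniqueness is assumed only among solutions bounded by \<open>C\<rho>\<close>, and \<open>U\<close> is not known to be one.
    On the compact interval both solutions lie in some ball, whose radius \<open>r\<close> may be large:
    the difference of the data is \<open>0\<close>, so the size of the constant \<open>L r\<close> is irrelevant.\<close>
  have UW: "U t = W t"
  proof -
    have "bounded (U ` {0..t} \<union> W ` {0..t})"
      by (intro bounded_Un[THEN iffD2] conjI compact_imp_bounded compact_continuous_image
          continuous_on_subset[OF cont(1)] continuous_on_subset[OF cont(2)]) auto
    then obtain r where r: "0 < r" "\<And>X. X \<in> U ` {0..t} \<union> W ` {0..t} \<Longrightarrow> norm X \<le> r"
      using bounded_pos by metis
    have "norm (U t - W t) \<le> 0"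
      using stable[OF r(1) t U W_sol g g] r(2) by simp
    then show ?thesis by simp
  qed
  \<comment> \<open>Comparison of the bounded solution with the equilibrium \<open>0\<close>, in the ball of radius \<open>C\<rho>\<close>.\<close>
  let ?N = "norm U0 + (LINT s:{0..\<tau>}|lebesgue. exp (\<omega> * s) * \<bar>k s\<bar> * norm (g s))"
  let ?K = "LINT s:{0..t}|lebesgue. \<bar>k (s + \<tau>)\<bar>"
  have "0 \<le> (LINT s:{0..\<tau>}|lebesgue. exp (\<omega> * s) * \<bar>k s\<bar> * norm (g s))"
    unfolding set_lebesgue_integral_def by (intro Bochner_Integration.integral_nonneg) simp
  then have N: "0 \<le> M * ?N" using M(1) by simp
  have "norm (U t) \<le> M * ?N * exp ((onorm B)\<^sup>2 * M * exp (\<omega> * \<tau>) * ?K + M * L C\<rho> * t - \<omega> * t)"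
    using stable[OF W(2) t W_sol zero g continuous_on_const] W_le' W(2) by (simp add: UW)
  also have "\<dots> \<le> M * ?N * exp (\<gamma> + - (\<omega> - \<omega>' - M * L C\<rho>) * t)"
    using k_growth[rule_format, OF t] by (intro mult_left_mono N) (simp add: algebra_simps)
  finally show "norm (U t) \<le> M * exp \<gamma> * ?N * exp (- (\<omega> - \<omega>' - M * L C\<rho>) * t)"
    by (simp add: exp_add mult_ac)
qed

end
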